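(* Let $\mathcal{G}$ be a strongly connected directed graph with $n$ vertices, $m$ edges and incidence matrix $B\in\mathbb{R}^{n\times m}$. Let $u^-,u^+\in\mathbb{R}^m$ satisfy $u_i^-<u_i^+$ for $i=1,\ldots,m$, and assume that $\mathcal{G}$ is compatible with the constraint intervals $[u_i^-,u_i^+]$, i.e. $u_i^+>0$ and $u_i^-\ge 0$ for all $i$. Let $H:\mathbb{R}^n\to\mathbb{R}$ be a twice differentiable function whose Hessian matrix is positive definite at every $x\in\mathbb{R}^n$. Consider the dynamical system $$\dot{x}=B\,\mathrm{sat}\Big(-B^T\tfrac{\partial H}{\partial x}(x)-x_c\,;u^-,u^+\Big),\qquad \dot{x}_c=B^T\tfrac{\partial H}{\partial x}(x),\qquad x(t)\in\mathbb{R}^n,\ x_c(t)\in\mathbb{R}^m .$$ Let $\mathcal{T}=(C_1,\ldots,C_k)$ be a minimal covering set of cycles for $\mathcal{G}$, let $\tilde{\mathcal{G}}(\mathcal{T})$ be the augmented graph based on $\mathcal{T}$, and let $\tilde{\mathcal{T}}=(\tilde C_1,\ldots,\tilde C_k)$ be a covering set of non-overlapping cycles for $\tilde{\mathcal{G}}(\mathcal{T})$. Suppose that there exists a splitting of the edges of $\mathcal{G}$ of multiplicity at least $2$ (that is, a choice of the splitting points of their constraint intervals) such that, for each $i=1,\ldots,k$, the intersection of the constraint intervals of all the edges of the cycle $\tilde C_i$ has non-empty interior. Then all trajectories $(x(t),x_c(t))$ of the system converge, as $t\to\infty$, to the set $$\mathcal{E}_{\mathrm{tot}}=\Big\{(x,x_c)\in\mathbb{R}^n\times\mathbb{R}^m\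 \Big|\ \tfrac{\partial H}{\partial x}(x)=\alpha\mathbf{1}\ \text{for some }\alpha\in\mathbb{R},\ \ B\,\mathrm{sat}(-x_c\,;u^-,u^+)=0\Big\}.$$
   Context: Directed graphs are finite, have no self-loops, and may have several parallel edges. The incidence matrix $B$ of a directed graph with $n$ vertices and $m$ edges is the $n\times m$ matrix whose $(i,j)$ entry is $1$ if edge $j$ points towards vertex $i$, $-1$ if edge $j$ originates from vertex $i$, and $0$ otherwise. A directed graph is strongly connected if every vertex can be reached from every other vertex by traversing edges along their directions. $\mathbf{1}$ is the all-ones vector, and $\frac{\partial H}{\partial x}(x)$ is the column vector of partial derivatives of $H$. For $a,b\in\mathbb{R}^m$ with $a_i<b_i$ for all $i$, the saturation function $\mathrm{sat}(\cdot\,;a,b):\mathbb{R}^m\to\mathbb{R}^m$ is defined componentwise: $\mathrm{sat}(z;a,b)_i$ equals $a_i$ if $z_i\le a_i$, $z_i$ if $a_i<z_i<b_i$, and $b_i$ if $z_i\ge b_i$. A trajectory is a solution on $[0,\infty)$ from an arbitrary initial condition. Convergence to a set means that the distance to the set tends to $0$. Cycles here are directed cycles (closed directed paths following the edge directions without repeated vertices). A covering set of cycles for a graph is a collection of cycles such that every edge of the graph lies in at least one of them. It is minimal if no proper subcollection is still covering. Cycles are non-overlapping if no two of them share an edge. Given a covering set $\mathcal{T}=(C_1,\ldots,C_k)$ of $\mathcal{G}$, the multiplicity vector $T\in\mathbb{R}^m$ has as $i$-th component $T_i$ the number of cycles in $\mathcal{T}$ containing the $i$-th edge. The augmented graph $\tilde{\mathcal{G}}(\mathcal{T})$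 has the same vertices as $\mathcal{G}$. Each edge $i$ of $\mathcal{G}$ is replaced by $T_i$ parallel edges $i_1,\ldots,i_{T_i}$ with the same tail and head as edge $i$. If $T_i=1$, the edge keeps its constraint interval $[u_i^-,u_i^+]$. If $T_i\ge 2$, a splitting of edge $i$ consists of real numbers $b_2,\ldots,b_{T_i}$ (depending on $i$) with $u_i^-<b_2<\cdots<b_{T_i}<u_i^+$, and the edges $i_1,\ldots,i_{T_i}$ then get, in this order, the constraint intervals $[u_i^-,b_2],\ [0,b_3-b_2],\ \ldots,\ [0,b_{T_i}-b_{T_i-1}],\ [0,u_i^+-b_{T_i}]$ (for $T_i=2$: $[u_i^-,b_2],\ [0,u_i^+-b_2]$). The graph $\tilde{\mathcal{G}}(\mathcal{T})$ is balanced (in-degree equals out-degree at each vertex) and can be covered by non-overlapping cycles.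
   Formalization: Distance to the empty set is taken to be 0, so nothing is claimed when E_tot is empty (no x has ∂H/∂x in the span of 1), where the original fails, e.g. H = exp(x1−x2)+(x1+x2)^2 on the 2-cycle with bounds [0,1]. *)

theory Defs
  imports "HOL-Analysis.Analysis" "Graph_Theory.Graph_Theory"
begin

section \<open>Partial derivatives\<close>

definition partial_deriv :: "'n::finite \<Rightarrow> (real ^ 'n \<Rightarrow> real) \<Rightarrow> real ^ 'n \<Rightarrow> real" where
  "partial_deriv i f x = deriv (\<lambda>s. f (x + s *\<^sub>R axis i 1)) 0"

definition gradient :: "(real ^ 'n::finite \<Rightarrow> real) \<Rightarrow> real ^ 'n \<Rightarrow> real ^ 'n" where
  "gradient f x = (\<chi> i. partial_deriv i f x)"

definition hessian :: "(real ^ 'n::finite \<Rightarrow> real) \<Rightarrow> real ^ 'n \<Rightarrow> real ^ 'n ^ 'n" where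
  "hessian f x = (\<chi> i j. partial_deriv i (partial_deriv j f) x)"

definition twice_differentiable :: "(real ^ 'n::finite \<Rightarrow> real) \<Rightarrow> bool" where
  "twice_differentiable f \<longleftrightarrow>
     (\<forall>x. f differentiable (at x)) \<and> (\<forall>x. gradient f differentiable (at x))"

text \<open>
  Symmetry is not part of this definition; it is only applied to Hessians of twice differentiable
  functions, which are symmetric anyway.
\<close>
definition positive_definite :: "real ^ 'n ^ 'n::finite \<Rightarrow> bool" where
  "positive_definite A \<longleftrightarrow> (\<forall>v. v \<noteq> 0 \<longrightarrow> v \<bullet> (A *v v) > 0)"


section \<open>The dynamical system\<close>

definition sat :: "real ^ 'm::finite \<Rightarrow> real ^ 'm \<Rightarrow> real ^ 'm \<Rightarrow> real ^ 'm" where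
  "sat z a b = (\<chi> i. if z $ i \<le> a $ i then a $ i else if z $ i < b $ i then z $ i else b $ i)"

text \<open>
  Vertices and edges are indexed by the finite types \<open>'n\<close> and \<open>'m\<close>. The matrix is the intended one
  for loop-free graphs whose arc set is all of \<open>'m\<close>.
\<close>
definition incidence_matrix :: "('n::finite, 'm::finite) pre_digraph \<Rightarrow> real ^ 'm ^ 'n" where
  "incidence_matrix G =
     (\<chi> i j. if head G j = i then 1 else if tail G j = i then - 1 else 0)"

definition trajectory ::
  "('n::finite, 'm::finite) pre_digraph \<Rightarrow> (real ^ 'n \<Rightarrow> real) \<Rightarrow> real ^ 'm \<Rightarrow> real ^ 'm \<Rightarrow>
     (real \<Rightarrow> real ^ 'n) \<Rightarrow> (real \<Rightarrow> real ^ 'm) \<Rightarrow> bool" where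
  "trajectory G H um up x xc \<longleftrightarrow>
     (\<forall>t\<ge>0.
        (x has_vector_derivative
           incidence_matrix G *v
             sat (- (transpose (incidence_matrix G) *v gradient H (x t)) - xc t) um up)
          (at t within {0..}) \<and>
        (xc has_vector_derivative transpose (incidence_matrix G) *v gradient H (x t))
          (at t within {0..}))"

text \<open>
  This set can be empty, e.g. for \<open>H x = exp (x\<^sub>1 - x\<^sub>2) + (x\<^sub>1 + x\<^sub>2)\<^sup>2\<close>. Note that the library's
  \<^const>\<open>infdist\<close> is \<open>0\<close> for the empty set.
\<close>
definition E_tot ::
  "('n::finite, 'm::finite) pre_digraph \<Rightarrow> (real ^ 'n \<Rightarrow> real) \<Rightarrow> real ^ 'm \<Rightarrow> real ^ 'm \<Rightarrow>
     ((real ^ 'n) \<times> (real ^ 'm)) set" where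
  "E_tot G H um up =
     {(x, xc). (\<exists>\<alpha>. gradient H x = \<alpha> *\<^sub>R vec 1) \<and> incidence_matrix G *v sat (- xc) um up = 0}"


section \<open>Covering sets of cycles\<close>

text \<open>
  Cycles are the library's arc lists, so that a cycle occurs once for each choice of its starting
  arc. Neither a minimal covering set nor a covering set of non-overlapping cycles contains two
  rotations of the same cycle. Covering sets in finite graphs are finite, since cycles have no
  repeated arcs.
\<close>
definition cycle_cover :: "('a, 'b) pre_digraph \<Rightarrow> 'b list set \<Rightarrow> bool" where
  "cycle_cover G T \<longleftrightarrow>
     (\<forall>C\<in>T. pre_digraph.cycle G C) \<and> (\<forall>e\<in>arcs G. \<exists>C\<in>T. e \<in> set C)"

definition minimal_cycle_cover :: "('a, 'b) pre_digraph \<Rightarrow> 'b list set \<Rightarrow> bool" where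
  "minimal_cycle_cover G T \<longleftrightarrow> cycle_cover G T \<and> (\<forall>S. S \<subset> T \<longrightarrow> \<not> cycle_cover G S)"

definition non_overlapping :: "'b list set \<Rightarrow> bool" where
  "non_overlapping T \<longleftrightarrow> pairwise (\<lambda>C D. set C \<inter> set D = {}) T"

definition edge_multiplicity :: "'b list set \<Rightarrow> 'b \<Rightarrow> nat" where
  "edge_multiplicity T e = card {C \<in> T. e \<in> set C}"


section \<open>The augmented graph\<close>

text \<open>The \<open>j\<close>-th parallel copy of the edge \<open>e\<close> is \<open>(e, j)\<close>, where \<open>j\<close> starts at \<open>1\<close>.\<close>
definition augmented_graph ::
  "('a, 'b) pre_digraph \<Rightarrow> 'b list set \<Rightarrow> ('a, 'b \<times> nat) pre_digraph" where
  "augmented_graph G T =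
     \<lparr>verts = verts G,
      arcs = {(e, j). e \<in> arcs G \<and> 1 \<le> j \<and> j \<le> edge_multiplicity T e},
      tail = (\<lambda>(e, j). tail G e),
      head = (\<lambda>(e, j). head G e)\<rparr>"

text \<open>
  The splitting points of an edge \<open>e\<close> are \<open>b e 2, \<dots>, b e (edge_multiplicity T e)\<close>; other values
  of \<open>b\<close> are irrelevant.
\<close>
definition splitting ::
  "'m::finite list set \<Rightarrow> real ^ 'm \<Rightarrow> real ^ 'm \<Rightarrow> ('m \<Rightarrow> nat \<Rightarrow> real) \<Rightarrow> bool" where
  "splitting T um up b \<longleftrightarrow>
     (\<forall>e. edge_multiplicity T e \<ge> 2 \<longrightarrow>
        um $ e < b e 2 \<and>
        (\<forall>j. 2 \<le> j \<and> j < edge_multiplicity T e \<longrightarrow> b e j < b e (j + 1)) \<and>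
        b e (edge_multiplicity T e) < up $ e)"

fun constraint_interval ::
  "'m::finite list set \<Rightarrow> real ^ 'm \<Rightarrow> real ^ 'm \<Rightarrow> ('m \<Rightarrow> nat \<Rightarrow> real) \<Rightarrow> 'm \<times> nat \<Rightarrow> real set"
where
  "constraint_interval T um up b (e, j) =
     (if edge_multiplicity T e = 1 then {um $ e..up $ e}
      else if j = 1 then {um $ e..b e 2}
      else if j < edge_multiplicity T e then {0..b e (j + 1) - b e j}
      else {0..up $ e - b e j})"

end

theory Submission
  imports Defs
begin

text \<open>
  The hypothesis on the cycles provides a circulation \<open>w\<close>, a vector with \<open>B *v w = 0\<close>, that lies
  strictly inside the constraints: send along each non-overlapping cycle \<open>C\<close> of the augmented graph
  a constant amount from the interior of the common constraint interval of its edges, and let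
  \<open>w $ e\<close> be the total amount on the copies of \<open>e\<close>. The intervals of the copies add up to
  \<open>{um $ e..up $ e}\<close>, so \<open>um $ e < w $ e < up $ e\<close> (\<open>interior_flow_exists\<close>).

  If no point has a gradient \<open>\<alpha> *\<^sub>R vec 1\<close>, then the limit set is empty and the claim is void. Otherwise
  let \<open>x_eq\<close> be such a point, let \<open>y = B\<^sup>T \<nabla>H(x)\<close> and let \<open>F\<^sub>e\<close> be an antiderivative of the scalar
  saturation with the bounds of the edge \<open>e\<close>. The energy
    \<open>V (x, xc) = H x - \<alpha> * (vec 1 \<bullet> x) + (\<Sum>e. F\<^sub>e (- xc $ e)) + w \<bullet> xc\<close>
  has a monotone gradient whose only zero is \<open>(x_eq, - w)\<close>; here it matters that \<open>w\<close> is strictly inside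
  the constraints. Hence its sublevel sets are bounded (\<open>sublevel_set_bounded_if_monotone_gradient\<close>).
  Along a trajectory the derivative of \<open>V\<close> is the negative of the dissipation
    \<open>D = y \<bullet> (sat (- xc) - sat (- xc - y)) \<ge> 0\<close>,
  so the trajectory stays in a compact set and \<open>D\<close> tends to \<open>0\<close> by Barbalat's lemma
  (\<open>bounded_and_dissipation_vanishes\<close>).

  The dissipation does not control \<open>y\<close> where saturation is active, and the Hessian of \<open>H\<close> need not be
  continuous, so neither \<open>D \<longlongrightarrow> 0\<close> alone nor differentiating the system once more yields \<open>y \<longlongrightarrow> 0\<close>.
  Instead, the proof follows functions that are slowly varying: over windows of any fixed length they
  eventually change arbitrarily little. A function whose derivative tends to \<open>0\<close> is slowly varying, a
  continuous function of a slowly varying bounded function is slowly varying, and a bounded function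
  with a slowly varying derivative has a derivative that tends to \<open>0\<close>
  (\<open>bounded_slowly_varying_derivative_tendsto_0\<close>). Vanishing dissipation means that \<open>xc\<close> moves slowly
  while it is not saturated; hence \<open>sat (- xc)\<close> is slowly varying, and so is \<open>x' = B *v sat (- xc - y)\<close>,
  as its distance to \<open>B *v sat (- xc)\<close> tends to \<open>0\<close>. Boundedness of \<open>x\<close> gives \<open>x' \<longlongrightarrow> 0\<close>, so \<open>x\<close> and
  then \<open>y\<close> vary slowly, and \<open>xc' = y\<close> with \<open>xc\<close> bounded gives \<open>y \<longlongrightarrow> 0\<close>. By compactness the trajectory
  approaches the common zeros of \<open>y\<close> and \<open>B *v sat (- xc)\<close>. In a connected graph \<open>y = 0\<close> says that the
  gradient is a multiple of \<open>vec 1\<close>, so this is the required set (\<open>infdist_E_tot_tendsto_0\<close>).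
\<close>


section \<open>Slowly varying functions and asymptotics of derivatives\<close>

definition slowly_varying :: "(real \<Rightarrow> 'a::metric_space) \<Rightarrow> bool" where
  "slowly_varying f \<longleftrightarrow>
     (\<forall>\<tau>>0. \<forall>\<epsilon>>0. \<forall>\<^sub>F t in at_top. \<forall>h\<in>{0..\<tau>}. dist (f (t + h)) (f t) < \<epsilon>)"

text \<open>
  On a window where \<open>f'\<close> is almost constant, \<open>f'\<close> is almost the difference quotient of \<open>f\<close>. The
  window may depend on the required accuracy, so this covers two opposite situations: \<open>f\<close> convergent
  with uniformly continuous \<open>f'\<close> (short windows), and \<open>f\<close> bounded with slowly varying \<open>f'\<close> (long
  windows).
\<close>
lemma derivative_tendsto_0:
  fixes f :: "real \<Rightarrow> 'a::real_normed_vector"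
  assumes der: "\<And>t. 0 \<le> t \<Longrightarrow> (f has_vector_derivative f' t) (at t within {0..})"
    and "\<And>\<epsilon>. 0 < \<epsilon> \<Longrightarrow> \<exists>\<tau>>0. \<forall>\<^sub>F t in at_top. norm (f (t + \<tau>) - f t) \<le> \<epsilon> * \<tau> \<and>
           (\<forall>h\<in>{0..\<tau>}. dist (f' (t + h)) (f' t) \<le> \<epsilon>)"
  shows "(f' \<longlongrightarrow> 0) at_top"
proof (rule tendstoI)
  fix e :: real assume "0 < e"
  obtain \<tau> where "\<tau> > 0" and ev: "\<forall>\<^sub>F t in at_top. norm (f (t + \<tau>) - f t) \<le> e / 3 * \<tau> \<and>
      (\<forall>h\<in>{0..\<tau>}. dist (f' (t + h)) (f' t) \<le> e / 3)"
    using assms(2)[of "e / 3"] \<open>0 < e\<close> by auto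
  show "\<forall>\<^sub>F t in at_top. dist (f' t) 0 < e"
    using ev eventually_ge_at_top[of 0]
  proof eventually_elim
    case (elim t)
    have "norm (f (t + \<tau>) - f t - (t + \<tau> - t) *\<^sub>R f' t) \<le> norm (t + \<tau> - t) * (e / 3)"
    proof (rule vector_differentiable_bound_linearization[where S = "{t..t + \<tau>}"])
      fix s assume s: "s \<in> {t..t + \<tau>}"
      then show "(f has_vector_derivative f' s) (at s within {t..t + \<tau>})"
        using elim by (intro has_vector_derivative_within_subset[OF der]) auto
      show "norm (f' s - f' t) \<le> e / 3"
        using elim s by (auto simp: dist_norm dest!: bspec[of _ _ "s - t"])
    qed (use \<open>\<tau> > 0\<close> in \<open>auto simp: closed_segment_eq_real_ivl\<close>)
    then have "norm (\<tau> *\<^sub>R f' t) \<le> e / 3 * \<tau> + e / 3 * \<tau>"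
      using elim \<open>\<tau> > 0\<close> norm_triangle_ineq4[of "f (t + \<tau>) - f t" "f (t + \<tau>) - f t - \<tau> *\<^sub>R f' t"]
      by (simp del: norm_scaleR add: mult.commute)
    then have "\<tau> * norm (f' t) \<le> \<tau> * (2 * e / 3)"
      using \<open>\<tau> > 0\<close> by (simp add: field_simps)
    then have "norm (f' t) \<le> 2 * e / 3"
      using \<open>\<tau> > 0\<close> by simp
    then show ?case using \<open>0 < e\<close> by simp
  qed
qed

lemma bounded_slowly_varying_derivative_tendsto_0:
  fixes f :: "real \<Rightarrow> 'a::real_normed_vector"
  assumes der: "\<And>t. 0 \<le> t \<Longrightarrow> (f has_vector_derivative f' t) (at t within {0..})"
    and bdd: "bounded (f ` {0..})" and slow: "slowly_varying f'"
  shows "(f' \<longlongrightarrow> 0) at_top"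
proof (rule derivative_tendsto_0[OF der])
  fix \<epsilon> :: real assume "0 < \<epsilon>"
  obtain M where M: "\<And>t. 0 \<le> t \<Longrightarrow> norm (f t) \<le> M" "M > 0"
    using bdd by (auto simp: bounded_pos)
  \<comment> \<open>On a window of this length the mean slope is at most \<open>\<epsilon>\<close>, since \<open>f\<close> changes by at most \<open>2 * M\<close>.\<close>
  define \<tau> where "\<tau> = 2 * M / \<epsilon>"
  have "\<tau> > 0" using M \<open>0 < \<epsilon>\<close> by (simp add: \<tau>_def)
  have "\<forall>\<^sub>F t in at_top. \<forall>h\<in>{0..\<tau>}. dist (f' (t + h)) (f' t) < \<epsilon>"
    using slow \<open>\<tau> > 0\<close> \<open>0 < \<epsilon>\<close> by (auto simp: slowly_varying_def)
  then have "\<forall>\<^sub>F t in at_top. norm (f (t + \<tau>) - f t) \<le> \<epsilon> * \<tau> \<and>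
           (\<forall>h\<in>{0..\<tau>}. dist (f' (t + h)) (f' t) \<le> \<epsilon>)"
    using eventually_ge_at_top[of 0]
  proof eventually_elim
    case (elim t)
    have "norm (f (t + \<tau>) - f t) \<le> M + M"
      using elim \<open>\<tau> > 0\<close> by (intro norm_triangle_le_diff add_mono M) auto
    also have "\<dots> = \<epsilon> * \<tau>" using \<open>0 < \<epsilon>\<close> by (simp add: \<tau>_def)
    finally show ?case using elim by (auto intro: less_imp_le)
  qed
  then show "\<exists>\<tau>>0. \<forall>\<^sub>F t in at_top. norm (f (t + \<tau>) - f t) \<le> \<epsilon> * \<tau> \<and>
           (\<forall>h\<in>{0..\<tau>}. dist (f' (t + h)) (f' t) \<le> \<epsilon>)"
    using \<open>\<tau> > 0\<close> by blast
qed

text \<open>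
  Barbalat's lemma.
\<close>
lemma convergent_uniformly_continuous_derivative_tendsto_0:
  fixes f :: "real \<Rightarrow> 'a::real_normed_vector"
  assumes der: "\<And>t. 0 \<le> t \<Longrightarrow> (f has_vector_derivative f' t) (at t within {0..})"
    and lim: "(f \<longlongrightarrow> L) at_top" and uc: "uniformly_continuous_on {0..} f'"
  shows "(f' \<longlongrightarrow> 0) at_top"
proof (rule derivative_tendsto_0[OF der])
  fix \<epsilon> :: real assume "0 < \<epsilon>"
  obtain d where "d > 0" and d: "\<And>s t. 0 \<le> s \<Longrightarrow> 0 \<le> t \<Longrightarrow> dist s t < d \<Longrightarrow> dist (f' s) (f' t) < \<epsilon>"
    using uc \<open>0 < \<epsilon>\<close> unfolding uniformly_continuous_on_def by (metis atLeast_iff)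
  define \<tau> where "\<tau> = d / 2"
  have "\<tau> > 0" using \<open>d > 0\<close> by (simp add: \<tau>_def)
  have "filterlim (\<lambda>t. t + \<tau>) at_top at_top"
    by (rule filterlim_tendsto_add_at_top[OF tendsto_const filterlim_ident, of \<tau>, simplified add.commute])
  then have "((\<lambda>t. f (t + \<tau>) - f t) \<longlongrightarrow> L - L) at_top"
    by (intro tendsto_intros lim filterlim_compose[OF lim])
  then have "\<forall>\<^sub>F t in at_top. norm (f (t + \<tau>) - f t) < \<epsilon> * \<tau>"
    using \<open>\<tau> > 0\<close> \<open>0 < \<epsilon>\<close> by (auto simp: tendsto_iff)
  then have "\<forall>\<^sub>F t in at_top. norm (f (t + \<tau>) - f t) \<le> \<epsilon> * \<tau> \<and>
           (\<forall>h\<in>{0..\<tau>}. dist (f' (t + h)) (f' t) \<le> \<epsilon>)"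
    using eventually_ge_at_top[of 0]
  proof eventually_elim
    case (elim t)
    have "dist (f' (t + h)) (f' t) < \<epsilon>" if "h \<in> {0..\<tau>}" for h
      using elim that \<open>d > 0\<close> by (intro d) (auto simp: dist_norm \<tau>_def)
    then show ?case using elim by (auto intro: less_imp_le)
  qed
  then show "\<exists>\<tau>>0. \<forall>\<^sub>F t in at_top. norm (f (t + \<tau>) - f t) \<le> \<epsilon> * \<tau> \<and>
           (\<forall>h\<in>{0..\<tau>}. dist (f' (t + h)) (f' t) \<le> \<epsilon>)"
    using \<open>\<tau> > 0\<close> by blast
qed

lemma norm_increment_le:
  fixes f :: "real \<Rightarrow> 'a::real_normed_vector"
  assumes der: "\<And>t. 0 \<le> t \<Longrightarrow> (f has_vector_derivative f' t) (at t within {0..})"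
    and "0 \<le> a" "a \<le> b" and bound: "\<And>s. a \<le> s \<Longrightarrow> s \<le> b \<Longrightarrow> norm (f' s) \<le> C"
  shows "norm (f b - f a) \<le> C * (b - a)"
proof -
  have "norm (f b - f a) \<le> C * norm (b - a)"
  proof (rule differentiable_bound[where S = "{a..b}" and f' = "\<lambda>s d. d *\<^sub>R f' s"])
    fix s assume s: "s \<in> {a..b}"
    then show "(f has_derivative (\<lambda>d. d *\<^sub>R f' s)) (at s within {a..b})"
      using assms(2)
      by (intro has_vector_derivative_within_subset[OF der, unfolded has_vector_derivative_def])
        auto
    have "onorm (\<lambda>d::real. d *\<^sub>R f' s) = norm (f' s)"
      using onorm_scaleR_left[of "\<lambda>d::real. d" "f' s"] by (simp add: onorm_id)
    then show "onorm (\<lambda>d. d *\<^sub>R f' s) \<le> C"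
      using bound s by auto
  qed (use assms in auto)
  then show ?thesis using assms by simp
qed

lemma slowly_varying_if_derivative_tendsto_0:
  fixes f :: "real \<Rightarrow> 'a::real_normed_vector"
  assumes der: "\<And>t. 0 \<le> t \<Longrightarrow> (f has_vector_derivative f' t) (at t within {0..})"
    and lim: "(f' \<longlongrightarrow> 0) at_top"
  shows "slowly_varying f"
  unfolding slowly_varying_def
proof (intro allI impI)
  fix \<tau> \<epsilon> :: real assume "0 < \<tau>" "0 < \<epsilon>"
  then have "\<forall>\<^sub>F t in at_top. norm (f' t) < \<epsilon> / (2 * \<tau>)"
    using lim by (auto simp: tendsto_iff)
  then obtain t0 where t0: "\<And>t. t0 \<le> t \<Longrightarrow> norm (f' t) < \<epsilon> / (2 * \<tau>)"
    by (auto simp: eventually_at_top_linorder)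
  have "dist (f (t + h)) (f t) < \<epsilon>" if "max 0 t0 \<le> t" "h \<in> {0..\<tau>}" for t h
  proof -
    have "norm (f (t + h) - f t) \<le> \<epsilon> / (2 * \<tau>) * (t + h - t)"
      using that t0 by (intro norm_increment_le[OF der]) (auto intro: less_imp_le)
    also have "\<dots> \<le> \<epsilon> / (2 * \<tau>) * \<tau>"
      using that \<open>0 < \<tau>\<close> \<open>0 < \<epsilon>\<close> by (intro mult_left_mono) auto
    also have "\<dots> < \<epsilon>"
      using \<open>0 < \<tau>\<close> \<open>0 < \<epsilon>\<close> by simp
    finally show ?thesis by (simp add: dist_norm)
  qed
  then show "\<forall>\<^sub>F t in at_top. \<forall>h\<in>{0..\<tau>}. dist (f (t + h)) (f t) < \<epsilon>"
    unfolding eventually_at_top_linorder by blast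
qed

lemma slowly_varying_cong:
  fixes f g :: "real \<Rightarrow> 'a::real_normed_vector"
  assumes slow: "slowly_varying f" and lim: "((\<lambda>t. g t - f t) \<longlongrightarrow> 0) at_top"
  shows "slowly_varying g"
  unfolding slowly_varying_def
proof (intro allI impI)
  fix \<tau> \<epsilon> :: real assume "0 < \<tau>" "0 < \<epsilon>"
  then have ev: "\<forall>\<^sub>F t in at_top. \<forall>h\<in>{0..\<tau>}. dist (f (t + h)) (f t) < \<epsilon> / 3"
    using slow by (simp add: slowly_varying_def del: less_divide_eq_numeral1)
  obtain t0 where t0: "\<And>t. t0 \<le> t \<Longrightarrow> norm (g t - f t) < \<epsilon> / 3"
    using lim \<open>0 < \<epsilon>\<close> unfolding tendsto_iff eventually_at_top_linorder
    by (metis dist_0_norm dist_commute divide_pos_pos zero_less_numeral)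
  show "\<forall>\<^sub>F t in at_top. \<forall>h\<in>{0..\<tau>}. dist (g (t + h)) (g t) < \<epsilon>"
    using ev eventually_ge_at_top[of t0]
  proof eventually_elim
    case (elim t)
    have "dist (g (t + h)) (g t) < \<epsilon>" if "h \<in> {0..\<tau>}" for h
    proof -
      have "dist (g (t + h)) (g t) \<le>
          dist (g (t + h)) (f (t + h)) + dist (f (t + h)) (f t) + dist (g t) (f t)"
        by metric
      moreover have "dist (f (t + h)) (f t) < \<epsilon> / 3" using elim that by blast
      moreover have "dist (g (t + h)) (f (t + h)) < \<epsilon> / 3" "dist (g t) (f t) < \<epsilon> / 3"
        using t0[of "t + h"] t0[of t] elim that by (simp_all add: dist_norm)
      ultimately show ?thesis by linarith
    qed
    then show ?case by blast
  qed
qed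

text \<open>
  On the compact part of \<open>K\<close> where \<open>\<phi>\<close> is at least \<open>\<epsilon>\<close>, the function \<open>\<psi>\<close> has no zero, so its norm has a
  positive minimum there.
\<close>
lemma small_on_compact_if_zeros_subset:
  fixes \<phi> :: "'a::metric_space \<Rightarrow> 'b::real_normed_vector" and \<psi> :: "'a \<Rightarrow> 'c::real_normed_vector"
  assumes "compact K" "continuous_on K \<phi>" "continuous_on K \<psi>"
    and "\<And>p. p \<in> K \<Longrightarrow> \<psi> p = 0 \<Longrightarrow> \<phi> p = 0" and "0 < \<epsilon>"
  obtains \<delta> where "\<delta> > 0" "\<And>p. p \<in> K \<Longrightarrow> norm (\<psi> p) < \<delta> \<Longrightarrow> norm (\<phi> p) < \<epsilon>"
proof -
  define S where "S = {p \<in> K. \<epsilon> \<le> norm (\<phi> p)}"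
  have "S = K \<inter> (\<lambda>p. norm (\<phi> p)) -` {\<epsilon>..}" by (auto simp: S_def)
  moreover have "closed (K \<inter> (\<lambda>p. norm (\<phi> p)) -` {\<epsilon>..})"
    by (intro continuous_closed_preimage continuous_on_norm assms compact_imp_closed closed_atLeast)
  ultimately have "compact S"
    using compact_Int_closed[OF assms(1)] by (metis inf.left_idem)
  show thesis
  proof (cases "S = {}")
    case True
    show thesis using True by (intro that[of 1]) (auto simp: S_def not_le)
  next
    case False
    have "continuous_on S (\<lambda>p. norm (\<psi> p))"
      by (intro continuous_intros continuous_on_subset[OF assms(3)]) (auto simp: S_def)
    then obtain p where p: "p \<in> S" "\<And>q. q \<in> S \<Longrightarrow> norm (\<psi> p) \<le> norm (\<psi> q)"
      using continuous_attains_inf[OF \<open>compact S\<close> False] by blast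
    have "\<psi> p \<noteq> 0" using p(1) assms(4,5) by (auto simp: S_def)
    then show thesis
      using p(2) by (intro that[of "norm (\<psi> p)"]) (force simp: S_def not_le)+
  qed
qed

lemma tendsto_0_if_zeros_subset:
  fixes \<phi> :: "'a::metric_space \<Rightarrow> 'b::real_normed_vector" and \<psi> :: "'a \<Rightarrow> 'c::real_normed_vector"
  assumes "compact K" "continuous_on K \<phi>" "continuous_on K \<psi>"
    and "\<And>p. p \<in> K \<Longrightarrow> \<psi> p = 0 \<Longrightarrow> \<phi> p = 0"
    and K: "\<And>t. 0 \<le> t \<Longrightarrow> \<gamma> t \<in> K"
    and lim: "((\<lambda>t. \<psi> (\<gamma> t)) \<longlongrightarrow> 0) at_top"
  shows "((\<lambda>t::real. \<phi> (\<gamma> t)) \<longlongrightarrow> 0) at_top"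
proof (rule tendstoI)
  fix e :: real assume "0 < e"
  obtain d where "d > 0" and d: "\<And>p. p \<in> K \<Longrightarrow> norm (\<psi> p) < d \<Longrightarrow> norm (\<phi> p) < e"
    using small_on_compact_if_zeros_subset[OF assms(1-4) \<open>0 < e\<close>] by blast
  have "\<forall>\<^sub>F t in at_top. dist (\<psi> (\<gamma> t)) 0 < d"
    by (rule tendstoD[OF lim \<open>d > 0\<close>])
  then show "\<forall>\<^sub>F t in at_top. dist (\<phi> (\<gamma> t)) 0 < e"
    using eventually_ge_at_top[of 0] by eventually_elim (use d K in auto)
qed

text \<open>
  \<open>f\<close> is a function of \<open>g\<close> on \<open>K\<close>, and this function is uniformly continuous because \<open>K\<close> is compact.
  Stating this by separation of points avoids an inverse of \<open>g\<close>.
\<close>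
lemma slowly_varying_if_separates:
  fixes g :: "'a::metric_space \<Rightarrow> 'b::real_normed_vector" and f :: "'a \<Rightarrow> 'c::real_normed_vector"
  assumes K: "compact K" "continuous_on K f" "continuous_on K g"
    and sep: "\<And>p q. p \<in> K \<Longrightarrow> q \<in> K \<Longrightarrow> g p = g q \<Longrightarrow> f p = f q"
    and \<gamma>: "\<And>t. 0 \<le> t \<Longrightarrow> \<gamma> t \<in> K"
    and slow: "slowly_varying (\<lambda>t. g (\<gamma> t))"
  shows "slowly_varying (\<lambda>t. f (\<gamma> t))"
  unfolding slowly_varying_def
proof (intro allI impI)
  fix \<tau> \<epsilon> :: real assume "0 < \<tau>" "0 < \<epsilon>"
  have f: "continuous_on (K \<times> K) (\<lambda>z. f (fst z) - f (snd z))"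
    by (intro continuous_on_diff; rule continuous_on_compose2[OF K(2)])
      (auto intro!: continuous_on_fst continuous_on_snd continuous_on_id)
  have g: "continuous_on (K \<times> K) (\<lambda>z. g (fst z) - g (snd z))"
    by (intro continuous_on_diff; rule continuous_on_compose2[OF K(3)])
      (auto intro!: continuous_on_fst continuous_on_snd continuous_on_id)
  have zeros: "f (fst z) - f (snd z) = 0" if "z \<in> K \<times> K" "g (fst z) - g (snd z) = 0" for z
    using sep[of "fst z" "snd z"] that by (simp add: mem_Times_iff)
  \<comment> \<open>On \<open>K \<times> K\<close>, the zeros of the difference of \<open>g\<close> are zeros of the difference of \<open>f\<close>.\<close>
  obtain d where "d > 0" and d: "\<And>z. z \<in> K \<times> K \<Longrightarrow> norm (g (fst z) - g (snd z)) < d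
      \<Longrightarrow> norm (f (fst z) - f (snd z)) < \<epsilon>"
    using small_on_compact_if_zeros_subset[OF compact_Times[OF K(1) K(1)] f g zeros \<open>0 < \<epsilon>\<close>]
    by blast
  have "\<forall>\<^sub>F t in at_top. \<forall>h\<in>{0..\<tau>}. dist (g (\<gamma> (t + h))) (g (\<gamma> t)) < d"
    using slow \<open>0 < \<tau>\<close> \<open>d > 0\<close> by (auto simp: slowly_varying_def)
  then show "\<forall>\<^sub>F t in at_top. \<forall>h\<in>{0..\<tau>}. dist (f (\<gamma> (t + h))) (f (\<gamma> t)) < \<epsilon>"
    using eventually_ge_at_top[of 0]
  proof eventually_elim
    case (elim t)
    show ?case
    proof
      fix h assume "h \<in> {0..\<tau>}"
      then show "dist (f (\<gamma> (t + h))) (f (\<gamma> t)) < \<epsilon>"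
        using d[of "(\<gamma> (t + h), \<gamma> t)"] \<gamma>[of t] \<gamma>[of "t + h"] elim by (simp add: dist_norm)
    qed
  qed
qed

section \<open>A flow strictly inside the constraints\<close>

lemma incidence_matrix_mult_vec_nth:
  assumes "loopfree_digraph G" "arcs G = UNIV"
  shows "(incidence_matrix G *v v) $ i =
           (\<Sum>e\<in>UNIV. v $ e * (of_bool (head G e = i) - of_bool (tail G e = i)))"
proof -
  interpret loopfree_digraph G by fact
  have "tail G e \<noteq> head G e" for e using no_loops assms(2) by auto
  note ne = this this[symmetric]
  show ?thesis
    unfolding incidence_matrix_def matrix_vector_mult_def using ne
    by (auto intro!: sum.cong)
qed

lemma transpose_incidence_matrix_mult_vec_nth:
  assumes "loopfree_digraph G" "arcs G = UNIV"
  shows "(transpose (incidence_matrix G) *v v) $ e = v $ head G e - v $ tail G e"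
proof -
  interpret loopfree_digraph G by fact
  have ne: "tail G e \<noteq> head G e" for e using no_loops assms(2) by auto
  have "(transpose (incidence_matrix G) *v v) $ e =
      (\<Sum>i\<in>UNIV. (if i = head G e then v $ i else 0) - (if i = tail G e then v $ i else 0))"
    unfolding incidence_matrix_def matrix_vector_mult_def transpose_def
    using ne[of e] by (auto intro!: sum.cong)
  also have "\<dots> = v $ head G e - v $ tail G e"
    by (simp add: sum_subtractf)
  finally show ?thesis .
qed

lemma equal_potentials_if_strongly_connected:
  fixes G :: "('n::finite, 'm::finite) pre_digraph"
  assumes "loopfree_digraph G" "verts G = UNIV" "arcs G = UNIV" "strongly_connected G"
    and "transpose (incidence_matrix G) *v v = 0"
  shows "\<exists>\<alpha>. v = \<alpha> *\<^sub>R vec 1"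
proof -
  have "v $ head G e = v $ tail G e" for e
    using transpose_incidence_matrix_mult_vec_nth[OF assms(1,3), of v e] assms(5) by simp
  then have step: "v $ i = v $ j" if "(i, j) \<in> arcs_ends G" for i j
    using that by (auto simp: arcs_ends_conv)
  have "v $ i = v $ j" for i j
  proof -
    have "(i, j) \<in> rtrancl_on (verts G) (arcs_ends G)"
      using assms(2,4) by (auto simp: strongly_connected_def reachable_def)
    then show ?thesis by induction (use step in auto)
  qed
  then have "v = v $ undefined *\<^sub>R vec 1" by (subst vec_eq_iff) simp
  then show ?thesis ..
qed

text \<open>For a closed walk the right-hand side is \<open>0\<close>: a unit flow along a cycle is a circulation.\<close>
lemma (in pre_digraph) sum_list_arcs_if_cas:
  assumes "cas u p v"
  shows "(\<Sum>e\<leftarrow>p. of_bool (head G e = i) - of_bool (tail G e = i) :: real)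
           = of_bool (v = i) - of_bool (u = i)"
  using assms by (induction u p v rule: cas.induct) auto

text \<open>
  The lower bounds of the intervals of the copies of \<open>e\<close> add up to \<open>um $ e\<close>. The upper bounds telescope:
  as long as copies remain, those of the first \<open>j\<close> copies add up to \<open>b e (j + 1)\<close>; in the end they
  add up to \<open>up $ e\<close>.
\<close>
lemma telescoping_copies_bounds:
  fixes c :: "nat \<Rightarrow> real"
  assumes "splitting T um up b" and mult: "1 \<le> edge_multiplicity T e"
    and c: "\<And>j. 1 \<le> j \<Longrightarrow> j \<le> edge_multiplicity T e \<Longrightarrow>
              c j \<in> interior (constraint_interval T um up b (e, j))"
  shows "um $ e < (\<Sum>j=1..edge_multiplicity T e. c j)"
    and "(\<Sum>j=1..edge_multiplicity T e. c j) < up $ e"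
proof -
  define k where "k = edge_multiplicity T e"
  have "um $ e < sum c {1..k} \<and> sum c {1..k} < up $ e"
  proof (cases "k = 1")
    case True
    then show ?thesis using c[of 1] by (simp add: k_def)
  next
    case False
    with mult have "2 \<le> k" by (simp add: k_def)
    have partial: "um $ e < sum c {1..j} \<and> sum c {1..j} < b e (j + 1)"
      if "1 \<le> j" "j < k" for j
      using that
    proof (induction j rule: dec_induct)
      case base
      then show ?case using c[of 1] by (simp add: k_def numeral_2_eq_2)
    next
      case (step j)
      then show ?case using c[of "Suc j"] by (simp add: k_def)
    qed
    have "sum c {1..k} = sum c {1..k - 1} + c k"
      using \<open>2 \<le> k\<close> by (cases k) auto
    moreover have "um $ e < sum c {1..k - 1} \<and> sum c {1..k - 1} < b e k"
      using partial[of "k - 1"] \<open>2 \<le> k\<close> by simp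
    moreover have "0 < c k \<and> c k < up $ e - b e k"
      using c[of k] \<open>2 \<le> k\<close> by (simp add: k_def)
    ultimately show ?thesis by linarith
  qed
  then show "um $ e < (\<Sum>j=1..edge_multiplicity T e. c j)"
    and "(\<Sum>j=1..edge_multiplicity T e. c j) < up $ e" by (auto simp: k_def)
qed

lemma wf_digraph_augmented_graph:
  assumes "wf_digraph G"
  shows "wf_digraph (augmented_graph G T)"
proof -
  interpret wf_digraph G by fact
  show ?thesis by unfold_locales (auto simp: augmented_graph_def)
qed

lemma finite_cycle_cover:
  assumes "wf_digraph G" "finite (arcs G)" "cycle_cover G T"
  shows "finite T"
proof (rule finite_subset)
  interpret wf_digraph G by fact
  show "T \<subseteq> {p. set p \<subseteq> arcs G \<and> distinct p}"
    using assms(3) by (auto simp: cycle_cover_def cycle_conv awalk_def)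
  show "finite {p. set p \<subseteq> arcs G \<and> distinct p}"
    using assms(2) by (rule finite_subset_distinct)
qed

lemma one_le_edge_multiplicity:
  assumes "wf_digraph G" "finite (arcs G)" "cycle_cover G T" "e \<in> arcs G"
  shows "1 \<le> edge_multiplicity T e"
proof -
  have "finite {C \<in> T. e \<in> set C}" using finite_cycle_cover[OF assms(1-3)] by simp
  moreover have "{C \<in> T. e \<in> set C} \<noteq> {}" using assms(3,4) by (auto simp: cycle_cover_def)
  ultimately show ?thesis
    unfolding edge_multiplicity_def by (simp add: Suc_le_eq card_gt_0_iff)
qed

lemma interior_flow_exists:
  fixes G :: "('n::finite, 'm::finite) pre_digraph" and um up :: "real ^ 'm"
  assumes G: "loopfree_digraph G" "arcs G = UNIV"
    and T: "cycle_cover G T"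
    and Tt: "cycle_cover (augmented_graph G T) Tt" "non_overlapping Tt"
    and b: "splitting T um up b"
    and int: "\<And>C. C \<in> Tt \<Longrightarrow> interior (\<Inter>e\<in>set C. constraint_interval T um up b e) \<noteq> {}"
  obtains w where "incidence_matrix G *v w = 0" "\<And>e. um $ e < w $ e" "\<And>e. w $ e < up $ e"
proof -
  interpret G: loopfree_digraph G by fact
  let ?A = "augmented_graph G T"
  interpret A: wf_digraph ?A by (rule wf_digraph_augmented_graph) unfold_locales
  define E where "E = arcs ?A"
  have E: "(e, j) \<in> E \<longleftrightarrow> 1 \<le> j \<and> j \<le> edge_multiplicity T e" for e j
    by (auto simp: E_def augmented_graph_def G)
  have E_Sigma: "E = (SIGMA e:UNIV. {1..edge_multiplicity T e})"
    using E by auto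
  have "finite E" unfolding E_Sigma by simp
  then have "finite Tt"
    using finite_cycle_cover[OF A.wf_digraph_axioms _ Tt(1)] by (simp add: E_def)
  have cyc: "\<exists>u. A.cas u C u" "distinct C" "set C \<subseteq> E" if "C \<in> Tt" for C
    using Tt(1) that by (auto simp: cycle_cover_def A.cycle_conv A.awalk_def E_def)
  have Un: "E = (\<Union>C\<in>Tt. set C)"
    using Tt(1) cyc(3) by (auto simp: cycle_cover_def E_def)
  have "\<forall>C\<in>Tt. \<exists>c. c \<in> interior (\<Inter>e\<in>set C. constraint_interval T um up b e)"
    using int by blast
  then obtain c where c: "\<And>C. C \<in> Tt \<Longrightarrow> c C \<in> interior (\<Inter>e\<in>set C. constraint_interval T um up b e)"
    by metis
  define f where "f a = (\<Sum>C | C \<in> Tt \<and> a \<in> set C. c C)" for a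
  \<comment> \<open>The cycles of \<open>Tt\<close> partition the copies, so each copy carries the value of a single cycle.\<close>
  have f_eq: "f a = c C" if "C \<in> Tt" "a \<in> set C" for a C
  proof -
    have "{C' \<in> Tt. a \<in> set C'} = {C}"
      using that Tt(2) by (auto simp: non_overlapping_def pairwise_def)
    then show ?thesis by (simp add: f_def)
  qed
  define w where "w = (\<chi> e. \<Sum>j=1..edge_multiplicity T e. f (e, j))"
  have f_int: "f a \<in> interior (constraint_interval T um up b a)" if "a \<in> E" for a
  proof -
    obtain C where C: "C \<in> Tt" "a \<in> set C" using \<open>a \<in> E\<close> Un by auto
    have "interior (\<Inter>e\<in>set C. constraint_interval T um up b e)
            \<subseteq> interior (constraint_interval T um up b a)"
      using C(2) by (intro interior_mono) auto
    then show ?thesis using c[OF C(1)] f_eq[OF C] by auto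
  qed
  have bounds: "um $ e < w $ e" "w $ e < up $ e" for e
  proof -
    have "1 \<le> edge_multiplicity T e"
      using one_le_edge_multiplicity[OF G.wf_digraph_axioms _ T] G(2) by simp
    moreover have "f (e, j) \<in> interior (constraint_interval T um up b (e, j))"
      if "1 \<le> j" "j \<le> edge_multiplicity T e" for j
      using f_int[of "(e, j)"] that E by blast
    ultimately show "um $ e < w $ e" "w $ e < up $ e"
      using telescoping_copies_bounds[OF b, of e "\<lambda>j. f (e, j)"] by (auto simp: w_def)
  qed
  have "(incidence_matrix G *v w) $ i = 0" for i
  proof -
    define d where "d a = (of_bool (head ?A a = i) - of_bool (tail ?A a = i) :: real)" for a
    have "(incidence_matrix G *v w) $ i = (\<Sum>e\<in>UNIV. \<Sum>j=1..edge_multiplicity T e. f (e, j) * d (e, j))"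
      by (simp add: incidence_matrix_mult_vec_nth[OF G] w_def sum_distrib_right d_def augmented_graph_def)
    also have "\<dots> = (\<Sum>a\<in>E. f a * d a)"
      unfolding E_Sigma by (subst sum.Sigma) auto
    also have "\<dots> = (\<Sum>C\<in>Tt. \<Sum>a\<in>set C. f a * d a)"
      unfolding Un using \<open>finite Tt\<close> Tt(2)
      by (subst sum.UNION_disjoint) (auto simp: non_overlapping_def pairwise_def)
    also have "\<dots> = (\<Sum>C\<in>Tt. c C * (\<Sum>a\<in>set C. d a))"
      by (simp add: f_eq sum_distrib_left)
    also have "\<dots> = (\<Sum>C\<in>Tt. c C * 0)"
    proof (rule sum.cong[OF refl])
      fix C assume "C \<in> Tt"
      then obtain u where "A.cas u C u" using cyc(1) by blast
      then have "sum_list (map d C) = 0"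
        unfolding d_def by (subst A.sum_list_arcs_if_cas) auto
      then show "c C * (\<Sum>a\<in>set C. d a) = c C * 0"
        using cyc(2)[OF \<open>C \<in> Tt\<close>] by (simp add: sum_list_distinct_conv_sum_set)
    qed
    finally show ?thesis by simp
  qed
  then have "incidence_matrix G *v w = 0" by (simp add: vec_eq_iff)
  then show thesis using bounds that by blast
qed

section \<open>Convex functions with monotone gradient\<close>

lemma mvt_gradient:
  fixes f :: "'a::euclidean_space \<Rightarrow> real"
  assumes "\<And>x. (f has_derivative (\<lambda>h. g x \<bullet> h)) (at x)"
  shows "\<exists>s. 0 < s \<and> s < 1 \<and> f y - f x = g (x + s *\<^sub>R (y - x)) \<bullet> (y - x)"
proof -
  have "((\<lambda>s. f (x + s *\<^sub>R (y - x))) has_real_derivative g (x + s *\<^sub>R (y - x)) \<bullet> (y - x)) (at s)" for s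
    unfolding has_field_derivative_def
    by (rule has_derivative_eq_rhs[OF has_derivative_compose[OF _ assms]])
      (auto intro!: derivative_eq_intros simp: fun_eq_iff)
  then obtain s where "0 < s" "s < 1"
    "f (x + 1 *\<^sub>R (y - x)) - f (x + 0 *\<^sub>R (y - x)) = (1 - 0) * (g (x + s *\<^sub>R (y - x)) \<bullet> (y - x))"
    using MVT2[of 0 1 "\<lambda>s. f (x + s *\<^sub>R (y - x))" "\<lambda>s. g (x + s *\<^sub>R (y - x)) \<bullet> (y - x)"] by auto
  then show ?thesis by (intro exI[of _ s]) simp
qed

text \<open>
  A function with monotone gradient lies above its tangents, and \<open>p\<close> is its strict minimum. On the unit
  sphere around \<open>p\<close> it exceeds \<open>f p\<close> by some \<open>\<delta> > 0\<close>, so by convexity along rays it grows at least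
  with slope \<open>\<delta>\<close> outside of the sphere. Strict monotonicity is assumed only with respect to \<open>p\<close>,
  because the primitive of a saturation function is affine outside of the saturation bounds.
\<close>
lemma sublevel_set_bounded_if_monotone_gradient:
  fixes f :: "'a::euclidean_space \<Rightarrow> real"
  assumes der: "\<And>x. (f has_derivative (\<lambda>h. g x \<bullet> h)) (at x)"
    and mono: "\<And>x y. 0 \<le> (g y - g x) \<bullet> (y - x)"
    and crit: "g p = 0" and strict: "\<And>x. x \<noteq> p \<Longrightarrow> 0 < g x \<bullet> (x - p)"
  shows "\<And>x. f p \<le> f x" and "bounded {x. f x \<le> c}"
proof -
  have sub: "f x + g x \<bullet> (y - x) \<le> f y" for x y
  proof -
    obtain s where s: "0 < s" "s < 1" "f y - f x = g (x + s *\<^sub>R (y - x)) \<bullet> (y - x)"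
      using mvt_gradient[OF der] by blast
    have "0 \<le> s * ((g (x + s *\<^sub>R (y - x)) - g x) \<bullet> (y - x))"
      using mono[of "x + s *\<^sub>R (y - x)" x] by simp
    then show ?thesis using s by (simp add: zero_le_mult_iff inner_diff_left)
  qed
  then show ge: "f p \<le> f x" for x using crit by (metis add.right_neutral inner_zero_left)
  have gt: "f p < f x" if "x \<noteq> p" for x
  proof -
    obtain s where s: "0 < s" "s < 1" "f x - f p = g (p + s *\<^sub>R (x - p)) \<bullet> (x - p)"
      using mvt_gradient[OF der] by blast
    have "0 < s * (g (p + s *\<^sub>R (x - p)) \<bullet> (x - p))"
      using strict[of "p + s *\<^sub>R (x - p)"] that s by simp
    then show ?thesis using s by (simp add: zero_less_mult_iff)
  qed
  have cont: "continuous_on (sphere p 1) f"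
    by (meson der has_derivative_continuous continuous_at_imp_continuous_on)
  obtain b :: 'a where "b \<in> Basis" using nonempty_Basis by blast
  then have "p + b \<in> sphere p 1" by (simp add: dist_norm)
  then have "sphere p 1 \<noteq> {}" by blast
  then obtain q where q: "q \<in> sphere p 1" "\<And>u. u \<in> sphere p 1 \<Longrightarrow> f q \<le> f u"
    using continuous_attains_inf[OF compact_sphere _ cont] by blast
  define \<delta> where "\<delta> = f q - f p"
  have "q \<noteq> p" using q(1) by auto
  then have "\<delta> > 0" using gt by (simp add: \<delta>_def)
  have growth: "r * \<delta> \<le> f x - f p" if "r = dist p x" "1 \<le> r" for x r
  proof -
    \<comment> \<open>the point where the ray from \<open>p\<close> to \<open>x\<close> meets the unit sphere\<close>
    define u where "u = p + (1 / r) *\<^sub>R (x - p)"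
    have "u \<in> sphere p 1" using that by (auto simp: u_def dist_norm norm_minus_commute)
    then have "\<delta> \<le> f u - f p" using q(2) by (simp add: \<delta>_def)
    have "x - u = (r - 1) *\<^sub>R (u - p)"
    proof -
      have "x - p = r *\<^sub>R (u - p)" using that by (simp add: u_def)
      then show ?thesis by (simp add: algebra_simps)
    qed
    then have "f u + (r - 1) * (g u \<bullet> (u - p)) \<le> f x"
      using sub[of u x] by simp
    moreover have "f u - f p \<le> g u \<bullet> (u - p)"
      using sub[of u p] by (simp add: inner_diff_right)
    then have "(r - 1) * \<delta> \<le> (r - 1) * (g u \<bullet> (u - p))"
      using \<open>\<delta> \<le> _\<close> that by (intro mult_left_mono) auto
    ultimately show ?thesis using \<open>\<delta> \<le> _\<close> by (simp add: algebra_simps)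
  qed
  show "bounded {x. f x \<le> c}"
    unfolding bounded_def
  proof (intro exI ballI)
    fix x assume "x \<in> {x. f x \<le> c}"
    then have "f x \<le> c" by simp
    show "dist p x \<le> max 1 ((c - f p) / \<delta>)"
    proof (cases "1 \<le> dist p x")
      case True
      then have "dist p x * \<delta> \<le> c - f p" using growth[OF refl True] \<open>f x \<le> c\<close> by simp
      then show ?thesis using \<open>\<delta> > 0\<close> by (simp add: pos_le_divide_eq le_max_iff_disj)
    qed simp
  qed
qed

lemma has_derivative_gradient:
  fixes f :: "real ^ 'n::finite \<Rightarrow> real"
  assumes "f differentiable (at x)"
  shows "(f has_derivative (\<lambda>h. gradient f x \<bullet> h)) (at x)"
    and "\<And>f'. (f has_derivative f') (at x) \<Longrightarrow> partial_deriv i f x = f' (axis i 1)"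
proof -
  have pd: "partial_deriv i f x = f' (axis i 1)" if f': "(f has_derivative f') (at x)" for f' i
  proof -
    interpret f': linear f' using f' by (rule has_derivative_linear)
    have "((\<lambda>s. f (x + s *\<^sub>R axis i 1)) has_derivative (\<lambda>s. f' (s *\<^sub>R axis i 1))) (at 0)"
      by (rule has_derivative_compose[of "\<lambda>s. x + s *\<^sub>R axis i 1"])
        (use f' in \<open>auto intro!: derivative_eq_intros\<close>)
    then have "((\<lambda>s. f (x + s *\<^sub>R axis i 1)) has_real_derivative f' (axis i 1)) (at 0)"
      unfolding has_field_derivative_def by (simp add: f'.scale mult_commute_abs)
    then show ?thesis unfolding partial_deriv_def by (rule DERIV_imp_deriv)
  qed
  then show "\<And>f'. (f has_derivative f') (at x) \<Longrightarrow> partial_deriv i f x = f' (axis i 1)" .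
  obtain f' where f': "(f has_derivative f') (at x)" using assms by (auto simp: differentiable_def)
  interpret f': linear f' using f' by (rule has_derivative_linear)
  have "f' h = gradient f x \<bullet> h" for h
  proof -
    have "f' h = f' (\<Sum>i\<in>UNIV. h $ i *\<^sub>R axis i 1)"
      using basis_expansion[of h] by (simp add: scalar_mult_eq_scaleR)
    also have "\<dots> = gradient f x \<bullet> h"
      by (simp add: f'.sum f'.scale gradient_def pd[OF f'] inner_vec_def mult.commute)
    finally show ?thesis .
  qed
  then show "(f has_derivative (\<lambda>h. gradient f x \<bullet> h)) (at x)" using f' by presburger
qed

text \<open>
  The derivative of \<open>gradient H\<close> is the transpose of \<open>hessian H\<close> and has the same quadratic form. As it
  need not be continuous, monotonicity comes from the mean value theorem along the segment from \<open>x\<close> to \<open>y\<close>.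
\<close>
lemma gradient_strictly_monotone:
  fixes H :: "real ^ 'n::finite \<Rightarrow> real"
  assumes H: "twice_differentiable H" and pos: "\<And>y. positive_definite (hessian H y)"
    and "x \<noteq> y"
  shows "0 < (gradient H y - gradient H x) \<bullet> (y - x)"
proof -
  define v where "v = y - x"
  have "\<forall>z. \<exists>J. (gradient H has_derivative J) (at z)"
    using H by (auto simp: twice_differentiable_def differentiable_def)
  then obtain J where J: "\<And>z. (gradient H has_derivative J z) (at z)" by metis
  have J_pos: "0 < v \<bullet> J z v" for z
  proof -
    interpret J: linear "J z" using J by (rule has_derivative_linear)
    have "((\<lambda>z. gradient H z $ j) has_derivative (\<lambda>h. J z h $ j)) (at z)" for j
      using J[of z] by (rule bounded_linear.has_derivative[OF bounded_linear_vec_nth])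
    moreover have "partial_deriv j H = (\<lambda>z. gradient H z $ j)" for j
      by (simp add: gradient_def)
    ultimately have "hessian H z $ i $ j = J z (axis i 1) $ j" for i j
      using has_derivative_gradient(2)[of "partial_deriv j H" z "\<lambda>h. J z h $ j" i]
      by (auto simp: hessian_def differentiable_def)
    then have "v \<bullet> (hessian H z *v v) = (\<Sum>i\<in>UNIV. \<Sum>j\<in>UNIV. v $ i * (J z (axis i 1) $ j * v $ j))"
      by (simp add: inner_vec_def matrix_vector_mult_def sum_distrib_left)
    also have "\<dots> = (\<Sum>j\<in>UNIV. v $ j * (\<Sum>i\<in>UNIV. v $ i *\<^sub>R J z (axis i 1)) $ j)"
      by (subst sum.swap) (simp add: sum_distrib_left mult_ac)
    also have "(\<Sum>i\<in>UNIV. v $ i *\<^sub>R J z (axis i 1)) = J z v"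
      using basis_expansion[of v] by (simp add: scalar_mult_eq_scaleR flip: J.sum J.scale)
    finally have "v \<bullet> (hessian H z *v v) = v \<bullet> J z v" by (simp add: inner_vec_def)
    moreover have "v \<noteq> 0" using \<open>x \<noteq> y\<close> by (simp add: v_def)
    ultimately show ?thesis using pos[of z] by (metis positive_definite_def)
  qed
  have "((\<lambda>s. gradient H (x + s *\<^sub>R v) \<bullet> v) has_real_derivative v \<bullet> J (x + s *\<^sub>R v) v) (at s)" for s
  proof -
    interpret J: linear "J (x + s *\<^sub>R v)" using J by (rule has_derivative_linear)
    have "((\<lambda>s. gradient H (x + s *\<^sub>R v)) has_derivative (\<lambda>r. J (x + s *\<^sub>R v) (r *\<^sub>R v))) (at s)"
      by (rule has_derivative_compose[OF _ J]) (auto intro!: derivative_eq_intros)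
    then have "((\<lambda>s. gradient H (x + s *\<^sub>R v) \<bullet> v) has_derivative
        (\<lambda>r. J (x + s *\<^sub>R v) (r *\<^sub>R v) \<bullet> v)) (at s)"
      by (rule has_derivative_inner_left)
    then show ?thesis
      unfolding has_field_derivative_def by (simp add: J.scale inner_commute mult_commute_abs)
  qed
  then have "gradient H (x + 0 *\<^sub>R v) \<bullet> v < gradient H (x + 1 *\<^sub>R v) \<bullet> v"
    using J_pos by (intro DERIV_pos_imp_increasing[of 0 1 "\<lambda>s. gradient H (x + s *\<^sub>R v) \<bullet> v"]) auto
  then show ?thesis by (simp add: v_def inner_diff_left)
qed

section \<open>Scalar saturation\<close>

definition clip :: "real \<Rightarrow> real \<Rightarrow> real \<Rightarrow> real" where
  "clip a b z = max a (min z b)"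

lemma sat_nth: "a $ i < b $ i \<Longrightarrow> sat z a b $ i = clip (a $ i) (b $ i) (z $ i)"
  by (auto simp: sat_def clip_def)

lemma continuous_on_clip [continuous_intros]:
  "continuous_on S f \<Longrightarrow> continuous_on S (\<lambda>x. clip a b (f x))"
  unfolding clip_def by (intro continuous_intros)

lemma clip_mono: "z \<le> z' \<Longrightarrow> clip a b z \<le> clip a b z'"
  by (auto simp: clip_def)

lemma clip_monotone: "0 \<le> (clip a b z - clip a b z') * (z - z')"
  using clip_mono[of z z' a b] clip_mono[of z' z a b]
  by (cases "z \<le> z'") (auto simp: zero_le_mult_iff)

lemma clip_strictly_monotone_inside:
  assumes "a < w" "w < b" "z \<noteq> w"
  shows "0 < (clip a b z - w) * (z - w)"
  using assms by (auto simp: clip_def zero_less_mult_iff min_def max_def)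

lemma antiderivative_exists:
  fixes f :: "real \<Rightarrow> real"
  assumes "continuous_on UNIV f"
  obtains F where "\<And>z. (F has_real_derivative f z) (at z)"
proof -
  have "\<exists>F. \<forall>x::real. -\<infinity> < ereal x \<longrightarrow> ereal x < \<infinity> \<longrightarrow> (F has_vector_derivative f x) (at x)"
    using assms by (intro einterval_antiderivative) (auto simp: continuous_on_eq_continuous_at)
  then show thesis
    using that by (auto simp: has_real_derivative_iff_has_vector_derivative)
qed

text \<open>
  \<open>bump\<close> is positive exactly in the interior of the saturation range. It weights the velocity of an edge
  state such that the velocity counts only where the saturation is inactive.
\<close>
definition bump :: "real \<Rightarrow> real \<Rightarrow> real \<Rightarrow> real" where
  "bump a b z = (clip a b z - a) * (b - clip a b z)"

lemma continuous_on_bump [continuous_intros]: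
  "continuous_on S f \<Longrightarrow> continuous_on S (\<lambda>x. bump a b (f x))"
  unfolding bump_def by (intro continuous_intros)

text \<open>
  \<open>M\<close> increases strictly between \<open>a\<close> and \<open>b\<close>, the only place where \<open>clip\<close> changes. So slow variation
  of \<open>M\<close> carries over to \<open>clip\<close>, and \<open>M\<close> is differentiable where \<open>clip\<close> is not.
\<close>
lemma bump_antiderivative_separates:
  assumes "a < b" and M: "\<And>z. (M has_real_derivative bump a b z) (at z)" and eq: "M z = M z'"
  shows "clip a b z = clip a b z'"
proof -
  have False if "M z = M z'" "clip a b z < clip a b z'" for z z'
  proof -
    have "0 \<le> bump a b u" for u
      using \<open>a < b\<close> by (simp add: bump_def clip_def)
    then have mono: "M u \<le> M v" if "u \<le> v" for u v
      using that M by (meson DERIV_nonneg_imp_nondecreasing)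
    define l r where "l = max z a" and "r = min z' b"
    have ord: "z \<le> l" "r \<le> z'" "l < r" "a \<le> l" "r \<le> b"
      using \<open>clip a b z < clip a b z'\<close> \<open>a < b\<close> by (auto simp: l_def r_def clip_def min_def max_def split: if_splits)
    have "M l < M r"
    proof (rule DERIV_pos_imp_increasing_open[OF \<open>l < r\<close>])
      fix u assume "l < u" "u < r"
      then show "\<exists>y. DERIV M u :> y \<and> 0 < y"
        using ord by (intro exI[of _ "bump a b u"] conjI M) (simp add: bump_def clip_def)
    qed (meson M DERIV_isCont continuous_at_imp_continuous_on)
    then show False using mono[of z l] mono[of r z'] ord \<open>M z = M z'\<close> by linarith
  qed
  from this[of z z'] this[of z' z] eq show ?thesis by fastforce
qed

text \<open>
  In the interior of the saturation range \<open>clip\<close> is injective, so no dissipation means \<open>y = 0\<close> there;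
  elsewhere the factor \<open>bump\<close> vanishes.
\<close>
lemma clip_dissipation_zero_imp:
  assumes "a < b" "y * (clip a b z - clip a b (z - y)) = 0"
  shows "clip a b (z - y) = clip a b z" and "bump a b z * y = 0"
  using assms by (auto simp: clip_def bump_def min_def max_def split: if_splits)

lemma clip_dissipation_nonneg: "0 \<le> y * (clip a b z - clip a b (z - y))"
  using clip_monotone[of a b z "z - y"] by (simp add: mult.commute)


section \<open>Convergence\<close>

lemma has_vector_derivative_vec_lambda:
  fixes f :: "real \<Rightarrow> 'i::finite \<Rightarrow> real"
  assumes "\<And>i. ((\<lambda>t. f t i) has_vector_derivative f' i) (at t within S)"
  shows "((\<lambda>t. \<chi> i. f t i) has_vector_derivative (\<chi> i. f' i)) (at t within S)"
  using assms unfolding has_vector_derivative_def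
  by (subst has_derivative_componentwise_within) (auto simp: Basis_vec_def inner_axis)

lemma antimono_bounded_below_tendsto:
  fixes f :: "real \<Rightarrow> real"
  assumes anti: "\<And>s t. 0 \<le> s \<Longrightarrow> s \<le> t \<Longrightarrow> f t \<le> f s" and lb: "\<And>t. 0 \<le> t \<Longrightarrow> l \<le> f t"
  shows "\<exists>L. (f \<longlongrightarrow> L) at_top"
proof -
  define L where "L = Inf (f ` {0..})"
  have bdd: "bdd_below (f ` {0..})" using lb by (intro bdd_belowI2[of _ l]) auto
  have "(f \<longlongrightarrow> L) at_top"
  proof (rule tendstoI)
    fix e :: real assume "0 < e"
    have "\<exists>z\<in>f ` {0..}. z < L + e"
      by (rule cInf_lessD) (use \<open>0 < e\<close> in \<open>auto simp: L_def\<close>)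
    then obtain t0 where "0 \<le> t0" "f t0 < L + e" by auto
    then have "dist (f t) L < e" if "t0 \<le> t" for t
      using anti[of t0 t] cInf_lower[OF _ bdd, of "f t"] that by (auto simp: L_def dist_real_def)
    then show "\<forall>\<^sub>F t in at_top. dist (f t) L < e"
      unfolding eventually_at_top_linorder by blast
  qed
  then show ?thesis ..
qed

lemma transpose_mult_vec_inner:
  fixes A :: "real ^ 'm::finite ^ 'n::finite"
  shows "(transpose A *v u) \<bullet> v = u \<bullet> (A *v v)"
  by (simp add: transpose_matrix_vector dot_lmul_matrix)

text \<open>
  The flow \<open>w\<close> and the point \<open>x_eq\<close> make \<open>(x_eq, - w)\<close> an equilibrium; they enter only through the energy.
\<close>
locale saturated_flow_system =
  fixes G :: "('n::finite, 'm::finite) pre_digraph"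
    and H :: "real ^ 'n \<Rightarrow> real"
    and um up w :: "real ^ 'm"
    and x_eq :: "real ^ 'n" and \<alpha> :: real
    and x :: "real \<Rightarrow> real ^ 'n" and xc :: "real \<Rightarrow> real ^ 'm"
  assumes G: "loopfree_digraph G" "verts G = UNIV" "arcs G = UNIV" "strongly_connected G"
    and um_less_up: "um $ e < up $ e"
    and H: "twice_differentiable H" "positive_definite (hessian H p)"
    and w: "incidence_matrix G *v w = 0" "um $ e < w $ e" "w $ e < up $ e"
    and x_eq: "gradient H x_eq = \<alpha> *\<^sub>R vec 1"
    and traj: "trajectory G H um up x xc"
begin

abbreviation B :: "real ^ 'm ^ 'n" where "B \<equiv> incidence_matrix G"
abbreviation S :: "real ^ 'm \<Rightarrow> real ^ 'm" where "S z \<equiv> sat z um up"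

definition y :: "(real ^ 'n) \<times> (real ^ 'm) \<Rightarrow> real ^ 'm" where
  "y p = transpose B *v gradient H (fst p)"

definition rhs :: "(real ^ 'n) \<times> (real ^ 'm) \<Rightarrow> (real ^ 'n) \<times> (real ^ 'm)" where
  "rhs p = (B *v S (- snd p - y p), y p)"

definition energy_gradient :: "(real ^ 'n) \<times> (real ^ 'm) \<Rightarrow> (real ^ 'n) \<times> (real ^ 'm)" where
  "energy_gradient p = (gradient H (fst p) - \<alpha> *\<^sub>R vec 1, w - S (- snd p))"

definition dissipation :: "(real ^ 'n) \<times> (real ^ 'm) \<Rightarrow> real" where
  "dissipation p = y p \<bullet> (S (- snd p) - S (- snd p - y p))"

abbreviation state :: "real \<Rightarrow> (real ^ 'n) \<times> (real ^ 'm)" where "state t \<equiv> (x t, xc t)"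

lemma S_nth: "S z $ e = clip (um $ e) (up $ e) (z $ e)"
  by (rule sat_nth[OF um_less_up])

lemma continuous_on_S: "continuous_on A f \<Longrightarrow> continuous_on A (\<lambda>p. S (f p))"
proof -
  assume "continuous_on A f"
  then have "continuous_on A (\<lambda>p. \<chi> e. clip (um $ e) (up $ e) (f p $ e))"
    by (intro continuous_intros)
  moreover have "S z = (\<chi> e. clip (um $ e) (up $ e) (z $ e))" for z
    by (simp add: vec_eq_iff S_nth)
  ultimately show ?thesis by simp
qed

lemma continuous_on_mult_vec: "continuous_on A f \<Longrightarrow> continuous_on A (\<lambda>p. M *v f p)"
  for M :: "real ^ 'i::finite ^ 'j::finite"
  by (rule bounded_linear.continuous_on[OF matrix_vector_mul_bounded_linear])

lemma continuous_on_y: "continuous_on A y"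
proof -
  have "continuous_on UNIV (gradient H)"
    using H(1) by (auto simp: twice_differentiable_def continuous_on_eq_continuous_at
      intro: differentiable_imp_continuous_within)
  then have "continuous_on A (\<lambda>p. gradient H (fst p))"
    by (rule continuous_on_compose2) (auto intro!: continuous_on_fst continuous_on_id)
  then show ?thesis unfolding y_def[abs_def] by (rule continuous_on_mult_vec)
qed

lemmas state_continuous_intros =
  continuous_on_S continuous_on_mult_vec continuous_on_y continuous_on_snd continuous_on_fst
  continuous_on_id continuous_on_minus continuous_on_diff continuous_on_Pair continuous_on_inner

lemma continuous_on_rhs: "continuous_on A rhs"
  unfolding rhs_def[abs_def] by (intro state_continuous_intros)

lemma continuous_on_dissipation: "continuous_on A dissipation"
  unfolding dissipation_def[abs_def] by (intro state_continuous_intros)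

lemma x_derivative:
  "0 \<le> t \<Longrightarrow> (x has_vector_derivative B *v S (- xc t - y (state t))) (at t within {0..})"
proof -
  have "- xc t - y (state t) = - (transpose B *v gradient H (x t)) - xc t" by (simp add: y_def)
  then show "0 \<le> t \<Longrightarrow> ?thesis" using traj unfolding trajectory_def by metis
qed

lemma xc_derivative: "0 \<le> t \<Longrightarrow> (xc has_vector_derivative y (state t)) (at t within {0..})"
  using traj unfolding trajectory_def y_def by simp

lemma state_derivative: "0 \<le> t \<Longrightarrow> (state has_vector_derivative rhs (state t)) (at t within {0..})"
  using x_derivative xc_derivative by (auto simp: rhs_def intro: has_vector_derivative_Pair)

lemma dissipation_eq_sum:
  "dissipation p = (\<Sum>e\<in>UNIV. y p $ e * (clip (um $ e) (up $ e) (- snd p $ e) -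
     clip (um $ e) (up $ e) (- snd p $ e - y p $ e)))"
  by (simp add: dissipation_def inner_vec_def S_nth)

lemma dissipation_nonneg: "0 \<le> dissipation p"
  unfolding dissipation_eq_sum by (intro sum_nonneg clip_dissipation_nonneg)

lemma dissipation_zeroD:
  assumes "dissipation p = 0"
  shows "S (- snd p - y p) = S (- snd p)"
    and "bump (um $ e) (up $ e) (- snd p $ e) * y p $ e = 0"
proof -
  have 0: "y p $ e * (clip (um $ e) (up $ e) (- snd p $ e) -
     clip (um $ e) (up $ e) (- snd p $ e - y p $ e)) = 0" for e
    using assms unfolding dissipation_eq_sum
    by (subst (asm) sum_nonneg_eq_0_iff) (auto intro: clip_dissipation_nonneg)
  show "S (- snd p - y p) = S (- snd p)"
    using clip_dissipation_zero_imp(1)[OF um_less_up 0] by (simp add: vec_eq_iff S_nth)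
  show "bump (um $ e) (up $ e) (- snd p $ e) * y p $ e = 0"
    using clip_dissipation_zero_imp(2)[OF um_less_up 0] by simp
qed

text \<open>
  The energy is used only through its gradient, so no closed form of the antiderivatives of the
  saturation is needed.
\<close>
lemma energy_exists:
  obtains V where "\<And>p. (V has_derivative (\<lambda>h. energy_gradient p \<bullet> h)) (at p)"
proof -
  have "\<exists>F. \<forall>z. (F has_real_derivative clip (um $ e) (up $ e) z) (at z)" for e
    using antiderivative_exists[of "clip (um $ e) (up $ e)"] continuous_on_clip[OF continuous_on_id]
    by metis
  then obtain F where F: "\<And>e z. (F e has_real_derivative clip (um $ e) (up $ e) z) (at z)"
    by metis
  define V where "V p = H (fst p) - \<alpha> * (vec 1 \<bullet> fst p) + (\<Sum>e\<in>UNIV. F e (- snd p $ e)) + w \<bullet> snd p"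
    for p :: "(real ^ 'n) \<times> (real ^ 'm)"
  have "(V has_derivative (\<lambda>h. energy_gradient p \<bullet> h)) (at p)" for p
  proof -
    have H': "((\<lambda>p. H (fst p)) has_derivative (\<lambda>h. gradient H (fst p) \<bullet> fst h)) (at p)"
      using H(1) unfolding twice_differentiable_def
      by (intro has_derivative_compose[OF bounded_linear_imp_has_derivative[OF bounded_linear_fst]]
          has_derivative_gradient) auto
    have F': "((\<lambda>p. F e (- snd p $ e)) has_derivative
        (\<lambda>h. clip (um $ e) (up $ e) (- snd p $ e) * (- snd h $ e))) (at p)" for e
    proof (rule has_derivative_compose[OF _ F[unfolded has_field_derivative_def]])
      have "bounded_linear (\<lambda>p::(real ^ 'n) \<times> (real ^ 'm). - (snd p $ e))"
        by (intro bounded_linear_minus bounded_linear_compose[OF bounded_linear_vec_nth bounded_linear_snd])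
      then show "((\<lambda>p. - snd p $ e) has_derivative (\<lambda>h. - snd h $ e)) (at p)"
        using bounded_linear_imp_has_derivative by auto
    qed
    have "(V has_derivative (\<lambda>h. gradient H (fst p) \<bullet> fst h - \<alpha> * (vec 1 \<bullet> fst h) +
        (\<Sum>e\<in>UNIV. clip (um $ e) (up $ e) (- snd p $ e) * (- snd h $ e)) + w \<bullet> snd h)) (at p)"
      unfolding V_def[abs_def]
      by (intro has_derivative_add has_derivative_diff has_derivative_sum H' F'
          has_derivative_mult_right has_derivative_inner_right has_derivative_fst
          has_derivative_snd has_derivative_ident)
    moreover have "energy_gradient p \<bullet> h = gradient H (fst p) \<bullet> fst h - \<alpha> * (vec 1 \<bullet> fst h) +
        (\<Sum>e\<in>UNIV. clip (um $ e) (up $ e) (- snd p $ e) * (- snd h $ e)) + w \<bullet> snd h" for h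
    proof -
      have "(\<Sum>e\<in>UNIV. clip (um $ e) (up $ e) (- snd p $ e) * (- snd h $ e)) = - (S (- snd p) \<bullet> snd h)"
        by (simp add: inner_vec_def S_nth sum_negf)
      then show ?thesis
        by (simp only: energy_gradient_def inner_prod_def inner_diff_left inner_scaleR_left fst_conv snd_conv)
    qed
    ultimately show ?thesis by presburger
  qed
  then show thesis using that by blast
qed

text \<open>
  Two terms vanish: \<open>vec 1\<close> is orthogonal to the range of \<open>B\<close>, and \<open>w\<close> to that of \<open>transpose B\<close>. By
  adjointness the rest pairs \<open>y\<close> with the difference of the saturated values at input \<open>y\<close> and at input \<open>0\<close>.
\<close>
lemma energy_gradient_inner_rhs: "energy_gradient p \<bullet> rhs p = - dissipation p"
proof -
  have "transpose B *v vec 1 = 0"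
    by (simp add: vec_eq_iff transpose_incidence_matrix_mult_vec_nth[OF G(1,3)]
        del: transpose_matrix_vector)
  then have "vec 1 \<bullet> (B *v v) = 0" for v
    by (metis inner_zero_left transpose_mult_vec_inner)
  moreover have "w \<bullet> y p = 0"
    unfolding y_def by (metis inner_commute inner_zero_right transpose_mult_vec_inner w(1))
  moreover have "gradient H (fst p) \<bullet> (B *v v) = y p \<bullet> v" for v
    unfolding y_def by (rule transpose_mult_vec_inner[symmetric])
  ultimately show ?thesis
    by (simp add: energy_gradient_def rhs_def dissipation_def inner_prod_def inner_diff_left
        inner_diff_right inner_commute)
qed

lemma energy_gradient_monotone: "0 \<le> (energy_gradient q - energy_gradient p) \<bullet> (q - p)"
proof -
  have "0 \<le> (gradient H (fst q) - gradient H (fst p)) \<bullet> (fst q - fst p)"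
    using gradient_strictly_monotone[OF H, of "fst p" "fst q"] by (cases "fst p = fst q") auto
  moreover have "0 \<le> (S (- snd p) - S (- snd q)) \<bullet> (snd q - snd p)"
    unfolding inner_vec_def
  proof (rule sum_nonneg)
    fix e
    show "0 \<le> (S (- snd p) - S (- snd q)) $ e \<bullet> (snd q - snd p) $ e"
      using clip_monotone[of "um $ e" "up $ e" "- snd p $ e" "- snd q $ e"] by (simp add: S_nth)
  qed
  ultimately show ?thesis by (simp add: energy_gradient_def inner_prod_def)
qed

text \<open>
  The component for \<open>xc\<close> is strict although \<open>sat\<close> is only weakly monotone, since every entry of \<open>w\<close> lies
  strictly between the bounds, where \<open>sat\<close> separates it from all other values.
\<close>
lemma energy_gradient_strict:
  assumes "p \<noteq> (x_eq, - w)"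
  shows "0 < energy_gradient p \<bullet> (p - (x_eq, - w))"
proof -
  have e: "0 \<le> (w - S (- snd p)) $ e \<bullet> (snd p + w) $ e"
    "snd p $ e \<noteq> - w $ e \<Longrightarrow> 0 < (w - S (- snd p)) $ e \<bullet> (snd p + w) $ e" for e
    using clip_strictly_monotone_inside[OF w(2,3)[of e], of "- snd p $ e"]
    by (cases "snd p $ e = - w $ e"; force simp: S_nth algebra_simps clip_def)+
  have *: "energy_gradient p \<bullet> (p - (x_eq, - w)) =
      (gradient H (fst p) - gradient H x_eq) \<bullet> (fst p - x_eq) + (w - S (- snd p)) \<bullet> (snd p + w)"
    by (simp add: energy_gradient_def inner_prod_def x_eq)
  show ?thesis
  proof (cases "fst p = x_eq")
    case True
    then obtain i where "snd p $ i \<noteq> - w $ i"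
      using assms by (auto simp: prod_eq_iff vec_eq_iff)
    then have "0 < (w - S (- snd p)) \<bullet> (snd p + w)"
      unfolding inner_vec_def by (intro sum_pos2[of _ i] e) auto
    then show ?thesis using True by (simp add: *)
  next
    case False
    have "0 \<le> (w - S (- snd p)) \<bullet> (snd p + w)"
      unfolding inner_vec_def by (intro sum_nonneg e)
    then show ?thesis
      using gradient_strictly_monotone[OF H, of x_eq "fst p"] False by (simp add: *)
  qed
qed

lemma energy_gradient_critical: "energy_gradient (x_eq, - w) = 0"
proof -
  have "S w = w"
    using w(2,3) by (simp add: vec_eq_iff S_nth clip_def less_imp_le)
  then show ?thesis by (simp add: energy_gradient_def x_eq zero_prod_def)
qed

lemma bounded_and_dissipation_vanishes:
  obtains K where "compact K" "\<And>t. 0 \<le> t \<Longrightarrow> state t \<in> K"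
    "((\<lambda>t. dissipation (state t)) \<longlongrightarrow> 0) at_top"
proof -
  obtain V where V: "\<And>p. (V has_derivative (\<lambda>h. energy_gradient p \<bullet> h)) (at p)"
    using energy_exists by blast
  have V': "((\<lambda>t. V (state t)) has_vector_derivative - dissipation (state t)) (at t within {0..})"
    if "0 \<le> t" for t
    using vector_derivative_diff_chain_within[OF state_derivative[OF that]
        has_derivative_at_withinI[OF V]]
    by (simp add: o_def energy_gradient_inner_rhs)
  have anti: "V (state t) \<le> V (state s)" if "0 \<le> s" "s \<le> t" for s t
  proof (rule DERIV_nonpos_imp_decreasing_open[where f = "\<lambda>t. V (state t)", OF that(2)])
    fix r assume "s < r" "r < t"
    then have "((\<lambda>t. V (state t)) has_vector_derivative - dissipation (state r)) (at r)"
      using V'[of r] that(1) at_within_interior[of r "{0..}"] by simp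
    then show "\<exists>d. DERIV (\<lambda>t. V (state t)) r :> d \<and> d \<le> 0"
      by (auto simp: has_real_derivative_iff_has_vector_derivative dissipation_nonneg)
  next
    have "continuous_on {0..} (\<lambda>t. V (state t))"
      unfolding continuous_on_eq_continuous_within
      using V' has_vector_derivative_continuous by blast
    then show "continuous_on {s..t} (\<lambda>t. V (state t))"
      by (rule continuous_on_subset) (use that(1) in auto)
  qed
  note sublevel = sublevel_set_bounded_if_monotone_gradient[OF V energy_gradient_monotone
      energy_gradient_critical energy_gradient_strict]
  \<comment> \<open>The energy does not increase, so the trajectory stays in its initial sublevel set.\<close>
  define K where "K = closure {p. V p \<le> V (state 0)}"
  have "compact K" unfolding K_def using sublevel(2) by (simp add: compact_closure)
  moreover have K: "state t \<in> K" if "0 \<le> t" for t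
    unfolding K_def by (rule subsetD[OF closure_subset]) (use anti[of 0 t] that in auto)
  moreover have "((\<lambda>t. dissipation (state t)) \<longlongrightarrow> 0) at_top"
  proof -
    obtain L where L: "((\<lambda>t. V (state t)) \<longlongrightarrow> L) at_top"
      using antimono_bounded_below_tendsto[of "\<lambda>t. V (state t)", OF anti sublevel(1)] by blast
    obtain C where C: "\<And>p. p \<in> K \<Longrightarrow> norm (rhs p) \<le> C" "C > 0"
      using compact_imp_bounded[OF compact_continuous_image[OF continuous_on_rhs \<open>compact K\<close>]]
      by (auto simp: bounded_pos)
    have lip: "dist (state s) (state t) \<le> C * dist s t" if "0 \<le> s" "0 \<le> t" for s t
    proof -
      have *: "dist (state s) (state t) \<le> C * dist s t" if "0 \<le> s" "s \<le> t" for s t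
        using norm_increment_le[OF state_derivative, of s t C] that C(1) K
        by (simp add: dist_norm norm_minus_commute[of "state s"] del: diff_Pair)
      show ?thesis using *[of s t] *[of t s] that by (cases "s \<le> t") (auto simp: dist_commute)
    qed
    have "uniformly_continuous_on {0..} (\<lambda>t. - dissipation (state t))"
      unfolding uniformly_continuous_on_def
    proof (intro allI impI)
      fix e :: real assume "0 < e"
      then obtain d where "d > 0"
        and d: "\<And>p q. p \<in> K \<Longrightarrow> q \<in> K \<Longrightarrow> dist p q < d \<Longrightarrow> dist (dissipation p) (dissipation q) < e"
        using compact_uniformly_continuous[OF continuous_on_dissipation \<open>compact K\<close>]
        unfolding uniformly_continuous_on_def by metis
      show "\<exists>d>0. \<forall>t\<in>{0..}. \<forall>s\<in>{0..}. dist s t < d \<longrightarrow>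
          dist (- dissipation (state s)) (- dissipation (state t)) < e"
      proof (intro exI[of _ "d / C"] conjI ballI impI)
        fix t s :: real assume st: "t \<in> {0..}" "s \<in> {0..}" "dist s t < d / C"
        then have "C * dist s t < d" using C(2) by (simp add: field_simps)
        then have "dist (dissipation (state s)) (dissipation (state t)) < e"
          using st lip[of s t] by (intro d K) auto
        then show "dist (- dissipation (state s)) (- dissipation (state t)) < e"
          by (simp add: dist_minus)
      qed (use \<open>d > 0\<close> C(2) in simp)
    qed
    from convergent_uniformly_continuous_derivative_tendsto_0[OF V' L this]
    show ?thesis using tendsto_minus by fastforce
  qed
  ultimately show thesis using that by blast
qed

text \<open>
  Slow variation passes from \<open>sat (- xc)\<close> to the velocity of \<open>x\<close>, and boundedness turns it into
  convergence, first for the velocity of \<open>x\<close> and then for that of \<open>xc\<close>.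
\<close>
theorem infdist_E_tot_tendsto_0: "((\<lambda>t. infdist (state t) (E_tot G H um up)) \<longlongrightarrow> 0) at_top"
proof -
  obtain K where K: "compact K" "\<And>t. 0 \<le> t \<Longrightarrow> state t \<in> K"
    and diss: "((\<lambda>t. dissipation (state t)) \<longlongrightarrow> 0) at_top"
    using bounded_and_dissipation_vanishes by blast
  have bdd: "bounded (x ` {0..})" "bounded (xc ` {0..})"
    using bounded_fst[OF compact_imp_bounded[OF K(1)]] bounded_snd[OF compact_imp_bounded[OF K(1)]] K(2)
    by (force intro: bounded_subset)+
  note vanish = tendsto_0_if_zeros_subset[OF K(1) _ continuous_on_dissipation _ K(2) diss]
  define sB where "sB t = B *v S (- xc t)" for t
  define x' where "x' t = B *v S (- xc t - y (state t))" for t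
  have diff: "((\<lambda>t. x' t - sB t) \<longlongrightarrow> 0) at_top"
  proof -
    have "continuous_on K (\<lambda>p. B *v S (- snd p - y p) - B *v S (- snd p))"
      by (intro state_continuous_intros)
    from vanish[OF this] show ?thesis
      by (simp add: x'_def sB_def dissipation_zeroD(1))
  qed
  have "\<exists>M. \<forall>z. (M has_real_derivative bump (um $ e) (up $ e) z) (at z)" for e
    using antiderivative_exists[of "bump (um $ e) (up $ e)"] continuous_on_bump[OF continuous_on_id]
    by metis
  then obtain M where M: "\<And>e z. (M e has_real_derivative bump (um $ e) (up $ e) z) (at z)"
    by metis
  define N where "N p = (\<chi> e. M e (- snd p $ e))" for p :: "(real ^ 'n) \<times> (real ^ 'm)"
  \<comment> \<open>The velocity of \<open>N\<close> is \<open>bump * y\<close>, which vanishes together with the dissipation.\<close>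
  have "slowly_varying (\<lambda>t. N (state t))"
  proof (rule slowly_varying_if_derivative_tendsto_0)
    fix t :: real assume "0 \<le> t"
    have "((\<lambda>t. M e (- xc t $ e)) has_vector_derivative
        - (bump (um $ e) (up $ e) (- xc t $ e) * y (state t) $ e)) (at t within {0..})" for e
    proof -
      have "((\<lambda>t. - xc t $ e) has_vector_derivative - y (state t) $ e) (at t within {0..})"
        using bounded_linear.has_vector_derivative[OF bounded_linear_vec_nth
            xc_derivative[OF \<open>0 \<le> t\<close>]]
        by (auto intro: has_vector_derivative_minus)
      from vector_derivative_diff_chain_within[OF this
          has_derivative_at_withinI[OF M[unfolded has_field_derivative_def]]]
      show ?thesis by (simp add: o_def)
    qed
    then show "((\<lambda>t. N (state t)) has_vector_derivative
        (\<chi> e. - (bump (um $ e) (up $ e) (- xc t $ e) * y (state t) $ e))) (at t within {0..})"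
      unfolding N_def by (intro has_vector_derivative_vec_lambda) simp
  next
    show "((\<lambda>t. \<chi> e. - (bump (um $ e) (up $ e) (- xc t $ e) * y (state t) $ e)) \<longlongrightarrow> 0) at_top"
    proof -
      have "continuous_on K (\<lambda>p. \<chi> e. - (bump (um $ e) (up $ e) (- snd p $ e) * y p $ e))"
        by (intro continuous_intros continuous_on_y)
      moreover have "(\<chi> e. - (bump (um $ e) (up $ e) (- snd p $ e) * y p $ e)) = 0"
        if "dissipation p = 0" for p
        using dissipation_zeroD(2)[OF that] by (simp add: vec_eq_iff)
      ultimately show ?thesis using vanish[of "\<lambda>p. \<chi> e. - (bump (um $ e) (up $ e) (- snd p $ e) * y p $ e)"]
        by simp
    qed
  qed
  then have "slowly_varying sB"
    unfolding sB_def[abs_def]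
  proof -
    assume N: "slowly_varying (\<lambda>t. N (state t))"
    have cS: "continuous_on K (\<lambda>p. B *v S (- snd p))" by (intro state_continuous_intros)
    have cN: "continuous_on K N"
      unfolding N_def
    proof (intro continuous_on_vec_lambda)
      fix e
      have "continuous_on UNIV (M e)"
        by (meson M DERIV_isCont continuous_at_imp_continuous_on)
      then show "continuous_on K (\<lambda>p. M e (- snd p $ e))"
        by (rule continuous_on_compose2) (auto intro!: continuous_intros)
    qed
    have sep: "B *v S (- snd p) = B *v S (- snd q)" if "N p = N q" for p q
    proof -
      have "M e (- snd p $ e) = M e (- snd q $ e)" for e
        using that by (simp add: N_def vec_eq_iff)
      then have "clip (um $ e) (up $ e) (- snd p $ e) = clip (um $ e) (up $ e) (- snd q $ e)" for e
        by (rule bump_antiderivative_separates[OF um_less_up M])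
      then have "S (- snd p) = S (- snd q)" by (simp add: vec_eq_iff S_nth)
      then show ?thesis by simp
    qed
    show "slowly_varying (\<lambda>t. B *v S (- xc t))"
      using slowly_varying_if_separates[where \<gamma> = state, OF K(1) cS cN sep K(2) N]
      by (simp only: snd_conv)
  qed
  then have "slowly_varying x'" using diff by (rule slowly_varying_cong)
  then have x': "(x' \<longlongrightarrow> 0) at_top"
    using bounded_slowly_varying_derivative_tendsto_0[OF _ bdd(1)] x_derivative by (simp add: x'_def)
  then have "slowly_varying x"
    using slowly_varying_if_derivative_tendsto_0[of x x'] x_derivative by (simp add: x'_def)
  then have "slowly_varying (\<lambda>t. y (state t))"
    by (intro slowly_varying_if_separates[OF K(1) continuous_on_y, of fst state] K(2))
      (auto simp: y_def continuous_on_fst continuous_on_id)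
  then have y: "((\<lambda>t. y (state t)) \<longlongrightarrow> 0) at_top"
    using bounded_slowly_varying_derivative_tendsto_0[OF xc_derivative bdd(2)] by blast
  have "((\<lambda>t. B *v S (- xc t)) \<longlongrightarrow> 0) at_top"
    using tendsto_diff[OF x' diff] by (simp add: sB_def)
  with y have lim: "((\<lambda>t. (y (state t), B *v S (- snd (state t)))) \<longlongrightarrow> 0) at_top"
    unfolding zero_prod_def by (intro tendsto_Pair) simp_all
  have cont: "continuous_on K (\<lambda>p. infdist p (E_tot G H um up))"
    "continuous_on K (\<lambda>p. (y p, B *v S (- snd p)))"
    by (intro continuous_on_infdist continuous_on_id, intro state_continuous_intros)
  have zeros: "infdist p (E_tot G H um up) = 0" if "p \<in> K" "(y p, B *v S (- snd p)) = 0" for p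
  proof -
    have "y p = 0" "B *v S (- snd p) = 0" using that(2) by (simp_all add: zero_prod_def)
    then have "p \<in> E_tot G H um up"
      using equal_potentials_if_strongly_connected[OF G, of "gradient H (fst p)"]
      by (cases p) (simp add: E_tot_def y_def)
    then show ?thesis by simp
  qed
  show ?thesis
    using tendsto_0_if_zeros_subset[where \<gamma> = state, OF K(1) cont zeros K(2) lim] by blast
qed

end

theorem theorem8:
  fixes G :: "('n::finite, 'm::finite) pre_digraph"
    and H :: "real ^ 'n \<Rightarrow> real"
    and um up :: "real ^ 'm"
    and T :: "'m list set"
    and Tt :: "('m \<times> nat) list set"
    and x :: "real \<Rightarrow> real ^ 'n"
    and xc :: "real \<Rightarrow> real ^ 'm"
  assumes "verts G = UNIV" and "arcs G = UNIV"
    and "loopfree_digraph G"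
    and "strongly_connected G"
    and "\<And>i. um $ i < up $ i"
    and "\<And>i. up $ i > 0" and "\<And>i. um $ i \<ge> 0"
    and "twice_differentiable H"
    and "\<And>y. positive_definite (hessian H y)"
    and "minimal_cycle_cover G T"
    and "cycle_cover (augmented_graph G T) Tt"
    and "non_overlapping Tt"
    and "card Tt = card T"
    and "\<exists>b. splitting T um up b \<and>
           (\<forall>C\<in>Tt. interior (\<Inter>e\<in>set C. constraint_interval T um up b e) \<noteq> {})"
    and "trajectory G H um up x xc"
  shows "((\<lambda>t. infdist (x t, xc t) (E_tot G H um up)) \<longlongrightarrow> 0) at_top"
proof (cases "\<exists>x_eq \<alpha>. gradient H x_eq = \<alpha> *\<^sub>R vec 1")
  case False
  \<comment> \<open>The distance to the empty set is \<open>0\<close> by convention.\<close>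
  then have "E_tot G H um up = {}" by (auto simp: E_tot_def)
  then show ?thesis by (simp add: infdist_def)
next
  case True
  then obtain x_eq \<alpha> where x_eq: "gradient H x_eq = \<alpha> *\<^sub>R vec 1" by blast
  obtain b where b: "splitting T um up b"
    "\<And>C. C \<in> Tt \<Longrightarrow> interior (\<Inter>e\<in>set C. constraint_interval T um up b e) \<noteq> {}"
    using assms(14) by blast
  have "cycle_cover G T" using assms(10) by (simp add: minimal_cycle_cover_def)
  then obtain w where w: "incidence_matrix G *v w = 0" "\<And>e. um $ e < w $ e" "\<And>e. w $ e < up $ e"
    using interior_flow_exists[OF assms(3,2) _ assms(11,12) b] by blast
  have "saturated_flow_system G H um up w x_eq \<alpha> x xc"
    by (rule saturated_flow_system.intro[OF assms(3,1,2,4,5,8,9) w x_eq assms(15)])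
  then show ?thesis by (rule saturated_flow_system.infdist_E_tot_tendsto_0)
qed

end
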